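(* Let $C\subseteq\mathbb{Z}_2^n$ be a $13$-cap of dimension $7$ with basis $B$, and write $D=C\setminus B=\{x_1,\dots,x_5\}$ and $B_{ij}=B_{x_i}\cap B_{x_j}$. Then $B$ has type $5\text{-}5\text{-}5\text{-}5\text{-}5$, and there are two disjoint pairs $\{i,j\},\{k,\ell\}\subseteq\{1,\dots,5\}$ with $|B_{ij}|=|B_{k\ell}|=2$, while $|B_{st}|=3$ for all other pairs $\{s,t\}$.
   Context: Work in $\mathbb{Z}_2^n$. An affine combination of a set is a sum of an odd number of its distinct elements; $\operatorname{aff}(S)$ is the set of all affine combinations of elements of $S$, and the dimension of $S$ is the dimension of the affine flat $\operatorname{aff}(S)$. A basis for $S$ is a subset $B\subseteq S$ that is affinely independent (no element is an affine combination of the others) with $\operatorname{aff}(B)=\operatorname{aff}(S)$; its dependent set is $D=S\setminus B$. For $x\in D$, $B_x$ is the unique subset of $B$ whose elements sum to $x$. A quad is a set of four distinct elements summing to $\mathbf{0}$; a cap is a quad-free subset; a $k$-cap is a cap with $k$ elements. The type of $B$ is the list of the numbers $|B_x|$, $x\in D$, in nonincreasing order, separated by hyphens. *)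

theory Defs
  imports "HOL-Analysis.Analysis" "HOL-Library.Z2" "HOL-Library.Multiset"
begin

definition aff :: "(bit ^ 'n) set \<Rightarrow> (bit ^ 'n) set" where
  "aff S = {\<Sum>T | T. T \<subseteq> S \<and> finite T \<and> odd (card T)}"

(* The dimension of a nonempty flat is that of its direction space; vec.dim is
   linear dimension over the coefficient field, here bit. The empty set gets 0. *)
definition flat_dim :: "(bit ^ 'n) set \<Rightarrow> nat" where
  "flat_dim F = vec.dim {x - y | x y. x \<in> F \<and> y \<in> F}"

definition cap_dim :: "(bit ^ 'n) set \<Rightarrow> nat" where
  "cap_dim S = flat_dim (aff S)"

definition aff_indep :: "(bit ^ 'n) set \<Rightarrow> bool" where
  "aff_indep B \<longleftrightarrow> (\<forall>x\<in>B. x \<notin> aff (B - {x}))"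

definition aff_basis :: "(bit ^ 'n) set \<Rightarrow> (bit ^ 'n) set \<Rightarrow> bool" where
  "aff_basis B S \<longleftrightarrow> B \<subseteq> S \<and> aff_indep B \<and> aff B = aff S"

(* Only subsets of odd size (affine combinations) are considered: without this the
   subset need not be unique, since for instance e1 + e2 = 0 + e1 + e2 if B = {0, e1, e2}. *)
definition basis_rep :: "(bit ^ 'n) set \<Rightarrow> bit ^ 'n \<Rightarrow> (bit ^ 'n) set" where
  "basis_rep B x = (THE T. T \<subseteq> B \<and> odd (card T) \<and> \<Sum>T = x)"

definition quad :: "(bit ^ 'n) set \<Rightarrow> bool" where
  "quad Q \<longleftrightarrow> card Q = 4 \<and> \<Sum>Q = 0"

definition cap :: "(bit ^ 'n) set \<Rightarrow> bool" where
  "cap C \<longleftrightarrow> \<not> (\<exists>Q\<subseteq>C. quad Q)"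

definition basis_type :: "(bit ^ 'n) set \<Rightarrow> (bit ^ 'n) set \<Rightarrow> nat list" where
  "basis_type S B =
     rev (sorted_list_of_multiset (image_mset (\<lambda>x. card (basis_rep B x)) (mset_set (S - B))))"

end

theory Submission
  imports Defs
begin

text \<open>
  The hypotheses are contradictory: no cap of dimension 7 has 13 elements. The basis \<open>B\<close> has
  8 elements, so there are five dependent points \<open>x\<close>; write each as the sum of an odd subset \<open>B\<^sub>x\<close>
  of \<open>B\<close> and put \<open>A\<^sub>x = B - B\<^sub>x\<close>. Quad-freeness says that \<open>|A\<^sub>x|\<close> is 1 or 3 and that the symmetric
  differences of two, three and four of the \<open>A\<^sub>x\<close> have sizes at least 4, at most 5 and at least 2.

  If all \<open>|A\<^sub>x| = 3\<close>, then two of them share at most one point, three of them share none, and among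
  any three at least two pairs meet. So each set meets at least three of the other four, whence at
  least eight pairs meet, and the symmetric difference of all five would have size at most
  \<open>15 - 2 * 8 < 0\<close>. If some \<open>|A\<^sub>x| = 1\<close>, the other four have size 3 and meet
  pairwise in exactly one point, with no three concurrent; their symmetric difference then has size
  \<open>12 - 2 * 6 = 0\<close>.
\<close>

section \<open>Counting in symmetric differences of finite sets\<close>

lemma card_sym_diff:
  assumes "finite A" "finite B"
  shows "int (card (sym_diff A B)) = int (card A) + int (card B) - 2 * int (card (A \<inter> B))"
proof -
  have "card (sym_diff A B) = card (A - B) + card (B - A)"
    using assms by (intro card_Un_disjoint) auto
  moreover have "card A = card (A - B) + card (A \<inter> B)" "card B = card (B - A) + card (A \<inter> B)"
    using assms card_Int_Diff[of A B] card_Int_Diff[of B A] by (auto simp: Int_commute)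
  ultimately show ?thesis by linarith
qed

lemma sym_diff_Int_distrib: "sym_diff A B \<inter> C = sym_diff (A \<inter> C) (B \<inter> C)"
  by blast

lemma card_sym_diff3:
  assumes "finite A" "finite B" "finite C"
  shows "int (card (sym_diff (sym_diff A B) C)) =
    int (card A) + int (card B) + int (card C)
    - 2 * (int (card (A \<inter> B)) + int (card (A \<inter> C)) + int (card (B \<inter> C)))
    + 4 * int (card (A \<inter> B \<inter> C))"
proof -
  have "A \<inter> C \<inter> (B \<inter> C) = A \<inter> B \<inter> C" by blast
  then show ?thesis
    using assms by (simp add: card_sym_diff sym_diff_Int_distrib)
qed

lemma no_five_sets:
  fixes A :: "'a \<Rightarrow> 'b set"
  assumes D: "card D = 5"
    and fin: "\<And>x. x \<in> D \<Longrightarrow> finite (A x)"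
    and size: "\<And>x. x \<in> D \<Longrightarrow> card (A x) = 1 \<or> card (A x) = 3"
    and two: "\<And>x y. \<lbrakk>x \<in> D; y \<in> D; x \<noteq> y\<rbrakk> \<Longrightarrow> card (sym_diff (A x) (A y)) \<ge> 4"
    and three: "\<And>x y z. \<lbrakk>x \<in> D; y \<in> D; z \<in> D; distinct [x, y, z]\<rbrakk> \<Longrightarrow>
      card (sym_diff (sym_diff (A x) (A y)) (A z)) \<le> 5"
    and four: "\<And>x y z w. \<lbrakk>x \<in> D; y \<in> D; z \<in> D; w \<in> D; distinct [x, y, z, w]\<rbrakk> \<Longrightarrow>
      card (sym_diff (sym_diff (sym_diff (A x) (A y)) (A z)) (A w)) \<ge> 2"
  shows False
proof -
  \<comment> \<open>Overlaps are integers, not naturals, because the inclusion-exclusion formulas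
    subtract them. In terms of \<open>m\<close> the size bounds become linear.\<close>
  define m where "m x y = int (card (A x \<inter> A y))" for x y
  have m_comm: "m x y = m y x" for x y by (simp add: m_def Int_commute)
  have m_nonneg: "m x y \<ge> 0" for x y by (simp add: m_def)
  have two': "int (card (A x)) + int (card (A y)) - 2 * m x y \<ge> 4"
    if "x \<in> D" "y \<in> D" "x \<noteq> y" for x y
    using two[OF that] card_sym_diff[of "A x" "A y"] fin that by (simp add: m_def)
  have three': "int (card (A x)) + int (card (A y)) + int (card (A z))
      - 2 * (m x y + m x z + m y z) + 4 * int (card (A x \<inter> A y \<inter> A z)) \<le> 5"
    if "x \<in> D" "y \<in> D" "z \<in> D" "distinct [x, y, z]" for x y z
    using three[OF that] card_sym_diff3[OF fin fin fin, OF that(1-3)]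
    unfolding m_def by linarith
  have triple: "A x \<inter> A y \<inter> A z = {} \<and> m x y + m x z + m y z \<ge> 2"
    if "x \<in> D" "y \<in> D" "z \<in> D" "distinct [x, y, z]"
      and 3: "card (A x) = 3" "card (A y) = 3" "card (A z) = 3" for x y z
  proof -
    have "m x y \<le> 1" "m x z \<le> 1" "m y z \<le> 1"
      using two'[of x y] two'[of x z] two'[of y z] that by auto
    \<comment> \<open>From 9 - 2s + 4t \<le> 5, with s the sum of the overlaps and t the size of the
      triple intersection. Since s \<le> 3, this leaves only t = 0, and then s \<ge> 2.\<close>
    moreover have "4 + 4 * int (card (A x \<inter> A y \<inter> A z)) \<le> 2 * (m x y + m x z + m y z)"
      using three'[OF that(1-4)] 3 by simp
    ultimately have "card (A x \<inter> A y \<inter> A z) = 0 \<and> m x y + m x z + m y z \<ge> 2"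
      by presburger
    then show ?thesis using fin[OF that(1)] by simp
  qed
  have fourfold: "int (card (sym_diff (sym_diff (sym_diff (A x) (A y)) (A z)) (A w))) =
      12 - 2 * (m x y + m x z + m x w + m y z + m y w + m z w)"
    if in_D: "x \<in> D" "y \<in> D" "z \<in> D" "w \<in> D" and dist: "distinct [x, y, z, w]"
      and 3: "card (A x) = 3" "card (A y) = 3" "card (A z) = 3" "card (A w) = 3" for x y z w
  proof -
    have "A x \<inter> A y \<inter> A z = {}" "A x \<inter> A y \<inter> A w = {}" "A x \<inter> A z \<inter> A w = {}"
      "A y \<inter> A z \<inter> A w = {}"
      using triple[of x y z] triple[of x y w] triple[of x z w] triple[of y z w] in_D dist 3 by auto
    \<comment> \<open>A point of \<open>A w\<close> lies in at most one of the other three sets, so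
      nothing cancels on \<open>A w\<close> and the pieces are disjoint.\<close>
    moreover from this have "sym_diff (sym_diff (A x) (A y)) (A z) \<inter> A w =
      (A x \<inter> A w) \<union> (A y \<inter> A w) \<union> (A z \<inter> A w)" by blast
    moreover from calculation have "card ((A x \<inter> A w) \<union> (A y \<inter> A w) \<union> (A z \<inter> A w)) =
      card (A x \<inter> A w) + card (A y \<inter> A w) + card (A z \<inter> A w)"
      using fin in_D by (subst card_Un_disjoint; (subst card_Un_disjoint)?) auto
    ultimately show ?thesis
      using card_sym_diff[of "sym_diff (sym_diff (A x) (A y)) (A z)" "A w"]
        card_sym_diff3[of "A x" "A y" "A z"] fin in_D 3
      by (simp add: m_def)
  qed
  show False
  proof (cases "\<exists>p\<in>D. card (A p) = 1")
    case True
    then obtain p where p: "p \<in> D" "card (A p) = 1" by blast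
    have "card (D - {p}) = 4" using D p by simp
    then obtain x y z w where D_eq: "D - {p} = {x, y, z, w}" and dist: "distinct [x, y, z, w]"
      by (auto simp: card_Suc_eq numeral_eq_Suc)
    then have in_D: "x \<in> D" "y \<in> D" "z \<in> D" "w \<in> D" and ne: "p \<noteq> x" "p \<noteq> y" "p \<noteq> z" "p \<noteq> w"
      by blast+
    \<comment> \<open>The bound 1 + |A u| - 2m \<ge> 4 excludes size 1 and, for size 3, any overlap
      with \<open>A p\<close>.\<close>
    have rest: "card (A u) = 3 \<and> m p u = 0" if "u \<in> D" "p \<noteq> u" for u
      using size[of u] two'[of p u] m_nonneg[of p u] p that by auto
    \<comment> \<open>With no overlaps with \<open>A p\<close>, the triple p, u, v gives 7 - 2m
      \<le> 5, so m \<ge> 1; the bound for pairs gives m \<le> 1.\<close>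
    have meet: "m u v = 1" if "u \<in> D" "v \<in> D" "u \<noteq> v" "p \<noteq> u" "p \<noteq> v" for u v
      using three'[of p u v] two'[of u v] rest[of u] rest[of v] p that by auto
    show False
      using four[OF in_D dist] fourfold[OF in_D dist] rest meet in_D ne dist by auto
  next
    case False
    then have 3: "card (A u) = 3" if "u \<in> D" for u using size that by blast
    obtain v where v: "v \<in> D" using D by fastforce
    then have "card (D - {v}) = 4" using D by simp
    then obtain x y z w where D_eq: "D - {v} = {x, y, z, w}" and "distinct [x, y, z, w]"
      by (auto simp: card_Suc_eq numeral_eq_Suc)
    then have dist: "distinct [v, x, y, z, w]" by auto
    have in_D: "v \<in> D" "x \<in> D" "y \<in> D" "z \<in> D" "w \<in> D" using v D_eq by blast+
    have le1: "m a b \<le> 1" if "a \<in> D" "b \<in> D" "a \<noteq> b" for a b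
      using two'[OF that] 3 that by simp
    define E where "E = sym_diff (sym_diff (sym_diff (A v) (A x)) (A y)) (A z)"
    have empty: "A a \<inter> A b \<inter> A c = {}" if "a \<in> D" "b \<in> D" "c \<in> D" "distinct [a, b, c]" for a b c
      using triple[OF that] 3 that by simp
    have disj: "A v \<inter> A x \<inter> A w = {}" "A v \<inter> A y \<inter> A w = {}" "A v \<inter> A z \<inter> A w = {}"
      "A x \<inter> A y \<inter> A w = {}" "A x \<inter> A z \<inter> A w = {}" "A y \<inter> A z \<inter> A w = {}"
      using in_D dist by (simp_all add: empty)
    then have "E \<inter> A w = (A v \<inter> A w) \<union> (A x \<inter> A w) \<union> (A y \<inter> A w) \<union> (A z \<inter> A w)"
      unfolding E_def by blast
    moreover have "card ((A v \<inter> A w) \<union> (A x \<inter> A w) \<union> (A y \<inter> A w) \<union> (A z \<inter> A w)) =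
        card (A v \<inter> A w) + card (A x \<inter> A w) + card (A y \<inter> A w) + card (A z \<inter> A w)"
      using disj fin in_D
      by (subst card_Un_disjoint; (subst card_Un_disjoint)?; (subst card_Un_disjoint)?) auto
    \<comment> \<open>The left side is the size of the symmetric difference of all five sets.
      Expanding \<open>card E\<close> by \<open>fourfold\<close> turns it into 15 minus twice the
      sum of the ten overlaps.\<close>
    moreover have "int (card E) + 3 - 2 * int (card (E \<inter> A w)) \<ge> 0"
      using card_sym_diff[of E "A w"] fin in_D 3[of w] by (auto simp: E_def)
    ultimately have upper: "2 * (m v x + m v y + m v z + m v w + m x y + m x z + m x w + m y z + m y w + m z w) \<le> 15"
      using fourfold[of v x y z] in_D dist 3 by (simp add: E_def m_def)
    have star: "m a b + m a c + m a d + m a e \<ge> 3"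
      if "a \<in> D" "b \<in> D" "c \<in> D" "d \<in> D" "e \<in> D" "distinct [a, b, c, d, e]" for a b c d e
    proof -
      \<comment> \<open>The three overlaps add up to at least 2, and the one avoiding
        \<open>a\<close> contributes at most 1. So no two of the four overlaps with \<open>a\<close>
        can both vanish.\<close>
      have pair: "m a s + m a t \<ge> 1" if "s \<in> D" "t \<in> D" "distinct [a, s, t]" for s t
        using triple[of a s t] le1[of s t] 3 \<open>a \<in> D\<close> that by simp
      have "m a b + m a c \<ge> 1" "m a b + m a d \<ge> 1" "m a b + m a e \<ge> 1"
        "m a c + m a d \<ge> 1" "m a c + m a e \<ge> 1" "m a d + m a e \<ge> 1"
        using that by (simp_all add: pair)
      then show ?thesis by presburger
    qed
    have "m v x + m v y + m v z + m v w \<ge> 3" "m v x + m x y + m x z + m x w \<ge> 3"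
      "m v y + m x y + m y z + m y w \<ge> 3" "m v z + m x z + m y z + m z w \<ge> 3"
      "m v w + m x w + m y w + m z w \<ge> 3"
      using star[of v x y z w] star[of x v y z w] star[of y v x z w] star[of z v x y w]
        star[of w v x y z] in_D dist
      by (auto simp: m_comm[of x v] m_comm[of y v] m_comm[of z v] m_comm[of w v] m_comm[of y x]
          m_comm[of z x] m_comm[of w x] m_comm[of z y] m_comm[of w y] m_comm[of w z])
    \<comment> \<open>Each of the ten overlaps occurs in exactly two of the five sums. Together with
      \<open>upper\<close> this makes the even number equal to 15, so parity finishes the
      case.\<close>
    from add_mono[OF add_mono[OF add_mono[OF add_mono[OF this(1,2)] this(3)] this(4)] this(5)]
    have "15 \<le> 2 * (m v x + m v y + m v z + m v w + m x y + m x z + m x w + m y z + m y w + m z w)"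
      by simp
    with upper have "2 * (m v x + m v y + m v z + m v w + m x y + m x z + m x w + m y z + m y w + m z w) = 15"
      by (rule antisym)
    then show False by presburger
  qed
qed

section \<open>Linear and affine algebra over the two-element field\<close>

lemma bit_vec_add_self [simp]: "x + x = (0 :: bit ^ 'n)"
  by (simp add: vec_eq_iff)

lemma bit_vec_diff_eq_add: "x - y = (x + y :: bit ^ 'n)"
  by (simp add: diff_eq_eq add.assoc)

lemma sum_sym_diff_bit_vec:
  fixes f :: "'a \<Rightarrow> bit ^ 'n"
  assumes "finite S" "finite T"
  shows "sum f (sym_diff S T) = sum f S + sum f T"
proof -
  have "sum f (sym_diff S T) = sum f (S - T) + sum f (T - S)"
    using assms by (intro sum.union_disjoint) auto
  moreover have "sum f S = sum f (S - T) + sum f (S \<inter> T)" "sum f T = sum f (T - S) + sum f (S \<inter> T)"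
    using assms sum.Int_Diff[of S f T] sum.Int_Diff[of T f S] by (auto simp: Int_commute add.commute)
  moreover have "(a + c) + (b + c) = a + b + (c + c)" for a b c :: "bit ^ 'n"
    by (simp only: ac_simps)
  ultimately show ?thesis by simp
qed

lemma sum_const_bit_vec: "(\<Sum>i\<in>T. a) = (if odd (card T) then a else (0 :: bit ^ 'n))"
proof (induction T rule: infinite_finite_induct)
  case (insert x F)
  then show ?case by (auto simp del: sum_constant)
qed (auto simp del: sum_constant)

text \<open>Copies of \<open>a\<close> cancel in pairs, so only the parity of \<open>T\<close>
  matters. This links linear combinations of differences with affine combinations of points.\<close>

lemma sum_diff_const_bit_vec:
  fixes f :: "'a \<Rightarrow> bit ^ 'n"
  shows "(\<Sum>i\<in>T. f i - a) = (if odd (card T) then sum f T + a else sum f T)"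
  by (simp add: bit_vec_diff_eq_add sum.distrib sum_const_bit_vec del: sum_constant)

text \<open>Coefficients are 0 or 1, so a linear combination is the sum over the support of its
  coefficients.\<close>

lemma span_bit_vec:
  assumes "finite S"
  shows "vec.span S = {\<Sum>T |T. T \<subseteq> (S :: (bit ^ 'n) set)}" (is "_ = ?R")
proof
  show "?R \<subseteq> vec.span S"
    by (auto intro!: vec.span_sum intro: vec.span_base)
  show "vec.span S \<subseteq> ?R"
  proof
    fix x assume "x \<in> vec.span S"
    then obtain u where u: "x = (\<Sum>v\<in>S. u v *s v)"
      using vec.span_finite[OF assms] by auto
    have "x = (\<Sum>v\<in>S. if u v = 1 then v else 0)"
      unfolding u by (intro sum.cong) auto
    also have "\<dots> = \<Sum>{v \<in> S. u v = 1}"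
      using assms by (simp add: sum.inter_filter)
    finally show "x \<in> ?R" by blast
  qed
qed

text \<open>Moving \<open>b0\<close> to the origin turns the remaining points of \<open>B\<close>
  into a linear basis of the direction space.\<close>

lemma flat_dim_aff_indep:
  fixes B :: "(bit ^ 'n) set"
  assumes fin: "finite B" and indep: "aff_indep B" and b0: "b0 \<in> B"
  shows "flat_dim (aff B) = card B - 1"
  unfolding flat_dim_def
proof (rule vec.dim_unique)
  let ?E = "(\<lambda>b. b - b0) ` (B - {b0})"
  let ?V = "{x - y |x y. x \<in> aff B \<and> y \<in> aff B}"
  have base: "b \<in> aff B" if "b \<in> B" for b
    using that unfolding aff_def by (auto intro!: exI[of _ "{b}"])
  show "?E \<subseteq> ?V" using base b0 by auto
  have *: "x - b0 \<in> vec.span ?E" if x: "x \<in> aff B" for x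
  proof -
    obtain T where T: "T \<subseteq> B" "odd (card T)" "x = \<Sum>T"
      using x unfolding aff_def by auto
    then have "(\<Sum>t\<in>T. t - b0) = x + b0"
      by (simp add: sum_diff_const_bit_vec)
    then have "x - b0 = (\<Sum>t\<in>T. t - b0)"
      by (simp only: bit_vec_diff_eq_add[of x b0])
    also have "\<dots> \<in> vec.span ?E"
    proof (rule vec.span_sum)
      fix t assume "t \<in> T"
      then show "t - b0 \<in> vec.span ?E"
        using T by (cases "t = b0") (auto intro: vec.span_base vec.span_zero)
    qed
    finally show ?thesis .
  qed
  show "?V \<subseteq> vec.span ?E"
  proof
    fix v assume "v \<in> ?V"
    then obtain x y where "v = (x - b0) - (y - b0)" "x \<in> aff B" "y \<in> aff B" by auto
    then show "v \<in> vec.span ?E" using * by (metis vec.span_diff)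
  qed
  have inj: "inj_on (\<lambda>b. b - b0) S" for S by (auto simp: inj_on_def)
  show "card ?E = card B - 1"
    using card_image[OF inj] b0 fin by simp
  show "vec.independent ?E"
    unfolding vec.dependent_def
  proof
    assume "\<exists>a\<in>?E. a \<in> vec.span (?E - {a})"
    then obtain b where b: "b \<in> B" "b \<noteq> b0" and "b - b0 \<in> vec.span (?E - {b - b0})"
      by blast
    moreover have "?E - {b - b0} = (\<lambda>b. b - b0) ` (B - {b0, b})" by auto
    ultimately obtain T where T: "T \<subseteq> B - {b0, b}" and "b - b0 = \<Sum>((\<lambda>b. b - b0) ` T)"
      using fin by (auto simp: span_bit_vec subset_image_iff)
    then have sum: "b - b0 = (\<Sum>t\<in>T. t - b0)"
      by (simp add: sum.reindex[OF inj])
    have finT: "finite T" using T fin finite_subset by blast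
    \<comment> \<open>For odd \<open>T\<close> the copies of \<open>b0\<close> on the two sides
      cancel; for even \<open>T\<close> the one on the left remains and joins \<open>T\<close>.
      Either way \<open>b\<close> is an odd sum of other basis points.\<close>
    define T' where "T' = (if odd (card T) then T else insert b0 T)"
    have "b0 \<notin> T" using T by blast
    moreover have "b - b0 = (if odd (card T) then \<Sum>T + b0 else \<Sum>T)"
      unfolding sum by (rule sum_diff_const_bit_vec)
    then have "b = (if odd (card T) then \<Sum>T + (b0 + b0) else \<Sum>T + b0)"
      by (auto simp: diff_eq_eq add.assoc simp del: bit_vec_add_self)
    ultimately have "b = \<Sum>T'" "odd (card T')"
      using finT unfolding T'_def by (auto simp: add.commute)
    moreover have "T' \<subseteq> B - {b}" "finite T'" using T b b0 finT by (auto simp: T'_def)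
    ultimately have "b \<in> aff (B - {b})" unfolding aff_def by blast
    with indep b show False unfolding aff_indep_def by blast
  qed
qed

section \<open>From quad-freeness to bounds on set sizes\<close>

lemma cap_card_ne_4:
  assumes "cap C" "I \<subseteq> C" "E \<subseteq> C" "I \<inter> E = {}" "finite I" "finite E" "\<Sum>I = \<Sum>E"
  shows "card I + card E \<noteq> 4"
proof
  assume "card I + card E = 4"
  \<comment> \<open>In characteristic 2 two equal sums add up to 0.\<close>
  then have "quad (I \<union> E)"
    using assms by (simp add: quad_def card_Un_disjoint sum.union_disjoint)
  then show False using assms unfolding cap_def by blast
qed

lemma even_card_sym_diff:
  assumes "finite A" "finite B"
  shows "even (card (sym_diff A B)) \<longleftrightarrow> (even (card A) \<longleftrightarrow> even (card B))"
proof -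
  have "even (int (card (sym_diff A B))) \<longleftrightarrow> (even (int (card A)) \<longleftrightarrow> even (int (card B)))"
    unfolding card_sym_diff[OF assms] by simp
  then show ?thesis by simp
qed

lemma no_13_cap_dim_7:
  fixes C B :: "(bit ^ 'n) set"
  assumes cap: "cap C" and card_C: "card C = 13" and dim: "cap_dim C = 7" and basis: "aff_basis B C"
  shows False
proof -
  define D where "D = C - B"
  have B: "B \<subseteq> C" "aff_indep B" "aff B = aff C"
    using basis by (auto simp: aff_basis_def)
  have finC: "finite C" using card_C card.infinite by fastforce
  then have finB: "finite B" using B finite_subset by blast
  have "\<exists>T \<subseteq> B. odd (card T) \<and> \<Sum>T = x" if "x \<in> D" for x
  proof -
    have "x \<in> aff C"
      using that unfolding aff_def D_def by (auto intro!: exI[of _ "{x}"])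
    then have "x \<in> aff B" using B by simp
    then show ?thesis unfolding aff_def by auto
  qed
  \<comment> \<open>Here \<open>f x\<close> serves as the representing set of \<open>x\<close>; the
    bounds below come from its containment in \<open>B\<close>, its parity and its sum.\<close>
  then obtain f where f: "\<And>x. x \<in> D \<Longrightarrow> f x \<subseteq> B \<and> odd (card (f x)) \<and> \<Sum>(f x) = x"
    by metis
  have fin: "finite (f x)" if "x \<in> D" for x
    using f[OF that] finB finite_subset by blast
  have "B \<noteq> {}"
  proof
    assume "B = {}"
    then have "D = {}" using f by fastforce
    with \<open>B = {}\<close> card_C show False by (simp add: D_def)
  qed
  then obtain b0 where "b0 \<in> B" by blast
  then have card_B: "card B = 8"
    using flat_dim_aff_indep[OF finB B(2)] dim B(3) by (fastforce simp: cap_dim_def)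
  have card_D: "card D = 5"
    using card_Diff_subset[OF finB B(1)] card_C card_B by (simp add: D_def)
  have no_quad: "card I + card E \<noteq> 4"
    if "I \<subseteq> D" "E \<subseteq> B" "\<Sum>I = \<Sum>E" for I E
    using that B finC finB by (intro cap_card_ne_4[OF cap]) (auto simp: D_def intro: finite_subset)
  \<comment> \<open>Complements turn sizes 5 and 7 into 3 and 1, small enough for the overlap count.
    Complementing cancels in a symmetric difference of two or four sets.\<close>
  define A where "A x = B - f x" for x
  have finA: "finite (A x)" for x using finB by (simp add: A_def)
  have card_A: "card (A x) = 8 - card (f x)" if "x \<in> D" for x
    unfolding A_def using card_Diff_subset[OF fin[OF that]] f[OF that] card_B by simp
  have sd2: "sym_diff (A x) (A y) = sym_diff (f x) (f y)" if "x \<in> D" "y \<in> D" for x y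
    using f[OF that(1)] f[OF that(2)] unfolding A_def by blast
  show False
  proof (rule no_five_sets[OF card_D finA])
    fix x assume x: "x \<in> D"
    \<comment> \<open>Size 1 would put \<open>x\<close> into \<open>B\<close>, and size 3 would
      complete \<open>x\<close> to a quad.\<close>
    have "card (f x) \<noteq> 1"
    proof
      assume "card (f x) = 1"
      then obtain b where "f x = {b}" by (rule card_1_singletonE)
      then show False using f[OF x] x by (auto simp: D_def)
    qed
    moreover have "card (f x) \<noteq> 3" using no_quad[of "{x}" "f x"] f[OF x] x by auto
    moreover have "odd (card (f x))" using f[OF x] by simp
    moreover have "card (f x) \<le> 8" using f[OF x] card_mono[OF finB] card_B by metis
    ultimately have "card (f x) = 5 \<or> card (f x) = 7" by presburger
    then show "card (A x) = 1 \<or> card (A x) = 3" using card_A[OF x] by auto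
  next
    fix x y assume x: "x \<in> D" and y: "y \<in> D" and ne: "x \<noteq> y"
    define E where "E = sym_diff (f x) (f y)"
    have sum: "\<Sum>E = x + y"
      unfolding E_def using sum_sym_diff_bit_vec[OF fin[OF x] fin[OF y], of "\<lambda>x. x"] f x y by simp
    \<comment> \<open>Size 2 would complete \<open>x\<close>, \<open>y\<close> to a quad, and size 0
      would force x = y; parity leaves at least 4.\<close>
    have "card E \<noteq> 2"
      using no_quad[of "{x, y}" E] sum ne x y f unfolding E_def by auto
    moreover have "card E \<noteq> 0"
    proof
      assume "card E = 0"
      then have "E = {}" using fin x y by (simp add: E_def)
      then have "f x = f y" unfolding E_def by blast
      then show False using f[OF x] f[OF y] ne by simp
    qed
    moreover have "even (card E)"
      unfolding E_def using even_card_sym_diff[OF fin[OF x] fin[OF y]] f x y by simp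
    ultimately have "card E \<ge> 4" by presburger
    then show "card (sym_diff (A x) (A y)) \<ge> 4" using sd2[OF x y] by (simp add: E_def)
  next
    fix x y z assume x: "x \<in> D" and y: "y \<in> D" and z: "z \<in> D" and dist: "distinct [x, y, z]"
    define E where "E = sym_diff (sym_diff (f x) (f y)) (f z)"
    have fin2: "finite (sym_diff (f x) (f y))" using fin x y by simp
    have sum: "\<Sum>E = x + y + z"
      unfolding E_def
      using sum_sym_diff_bit_vec[OF fin2 fin[OF z], of "\<lambda>x. x"]
        sum_sym_diff_bit_vec[OF fin[OF x] fin[OF y], of "\<lambda>x. x"] f x y z by simp
    have E_sub: "E \<subseteq> B" using f[OF x] f[OF y] f[OF z] unfolding E_def by blast
    have "card E \<noteq> 1"
      using no_quad[of "{x, y, z}" E] sum dist x y z E_sub by (auto simp: add.assoc)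
    moreover have "odd (card E)"
      unfolding E_def using even_card_sym_diff[OF fin2 fin[OF z]]
        even_card_sym_diff[OF fin[OF x] fin[OF y]] f x y z by simp
    ultimately have "card E \<ge> 3" by presburger
    \<comment> \<open>Complementing an odd number of sets complements their symmetric difference, so
      the lower bound 3 becomes the upper bound 8 - 3 = 5.\<close>
    moreover have "sym_diff (sym_diff (A x) (A y)) (A z) = B - E"
      using f[OF x] f[OF y] f[OF z] unfolding A_def E_def by blast
    ultimately show "card (sym_diff (sym_diff (A x) (A y)) (A z)) \<le> 5"
      using card_Diff_subset[OF finite_subset[OF E_sub finB] E_sub] card_B by simp
  next
    fix x y z w assume x: "x \<in> D" and y: "y \<in> D" and z: "z \<in> D" and w: "w \<in> D"
      and dist: "distinct [x, y, z, w]"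
    define E where "E = sym_diff (sym_diff (sym_diff (f x) (f y)) (f z)) (f w)"
    have fin2: "finite (sym_diff (f x) (f y))" using fin x y by simp
    have fin3: "finite (sym_diff (sym_diff (f x) (f y)) (f z))" using fin x y z by simp
    have sum: "\<Sum>E = x + y + z + w"
      unfolding E_def
      using sum_sym_diff_bit_vec[OF fin3 fin[OF w], of "\<lambda>x. x"]
        sum_sym_diff_bit_vec[OF fin2 fin[OF z], of "\<lambda>x. x"]
        sum_sym_diff_bit_vec[OF fin[OF x] fin[OF y], of "\<lambda>x. x"] f x y z w by simp
    have E_sub: "E \<subseteq> B" using f[OF x] f[OF y] f[OF z] f[OF w] unfolding E_def by blast
    \<comment> \<open>If \<open>E\<close> were empty, the four dependent points themselves would
      form a quad.\<close>
    have "card E \<noteq> 0"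
      using no_quad[of "{x, y, z, w}" E] sum dist x y z w E_sub by (auto simp: add.assoc)
    moreover have "even (card E)"
      unfolding E_def using even_card_sym_diff[OF fin3 fin[OF w]] even_card_sym_diff[OF fin2 fin[OF z]]
        even_card_sym_diff[OF fin[OF x] fin[OF y]] f x y z w by simp
    ultimately have "card E \<ge> 2" by presburger
    moreover have "sym_diff (sym_diff (sym_diff (A x) (A y)) (A z)) (A w) = E"
      using f[OF x] f[OF y] f[OF z] f[OF w] unfolding A_def E_def by blast
    ultimately show "card (sym_diff (sym_diff (sym_diff (A x) (A y)) (A z)) (A w)) \<ge> 2" by simp
  qed
qed

theorem theorem8p1:
  fixes C B :: "(bit ^ 'n) set"
  assumes "cap C" and "card C = 13" and "cap_dim C = 7" and "aff_basis B C"
  shows "basis_type C B = [5, 5, 5, 5, 5] \<and>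
    (\<forall>x :: nat \<Rightarrow> bit ^ 'n. bij_betw x {1..5} (C - B) \<longrightarrow>
      (\<exists>i\<in>{1..5}. \<exists>j\<in>{1..5}. \<exists>k\<in>{1..5}. \<exists>l\<in>{1..5}.
        distinct [i, j, k, l] \<and>
        card (basis_rep B (x i) \<inter> basis_rep B (x j)) = 2 \<and>
        card (basis_rep B (x k) \<inter> basis_rep B (x l)) = 2 \<and>
        (\<forall>s\<in>{1..5}. \<forall>t\<in>{1..5}. s \<noteq> t \<and> {s, t} \<noteq> {i, j} \<and> {s, t} \<noteq> {k, l} \<longrightarrow>
          card (basis_rep B (x s) \<inter> basis_rep B (x t)) = 3)))"
  using no_13_cap_dim_7[OF assms] by blast

end
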